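(* Let $n\ge1$, let $\mathfrak p_0\in A=\mathbb F_q[T]$ be monic irreducible of degree $r$ with $\gcd(n,r)=1$, let $t\in\mathbb F_{q^r}$ be a root of $\mathfrak p_0$, let $\phi$ be the Drinfeld module with $\phi_T=t+\tau^n$, let $\mathfrak p\neq\mathfrak p_0$ be a monic irreducible element of $A$, and let $m\mid n$. With $M=\phi[\mathfrak p]$, $R$, $S$ and $\operatorname{wt}$ as defined in the context, let $\alpha\in M$ be $S$-normal, let $0\ne f\in R$, and let $\delta$ be an integer. If $$Z(f)=\{v\in M: f(v)=0\}\supseteq\{\alpha^{[ri]}:\ 0\le i\le\delta-2\},$$ then $\operatorname{wt}(f)\ge\delta$.
   Context: $q$ is a prime power, $A=\mathbb F_q[T]$, $\overline{\mathbb F}_q$ a fixed algebraic closure, $[i]=q^i$, $\beta^{[i]}=\beta^{q^i}$. Twisted polynomials in $\tau$ satisfy $\tau a=a^q\tau$ and act on $\overline{\mathbb F}_q$ with $\tau$ acting as $x\mapsto x^q$ and constants by multiplication. $\phi\colon A\to\mathbb F_{q^r}\{\tau\}$, $a\mapsto\phi_a$, is the $\mathbb F_q$-algebra homomorphism with $\phi_T=t+\tau^n$. Put $d=\deg\mathfrak p$, $\kappa=A/\mathfrak p\cong\mathbb F_{q^d}$ and $M=\phi[\mathfrak p]=\{v\in\overline{\mathbb F}_q:\phi_{\mathfrak p}(v)=0\}$, a $\kappa$-vector space of dimension $n$ via $a\cdot v=\phi_a(v)$; $E=\operatorname{End}_\kappa(M)$; $\pi=\tau^r$, acting on $M$ by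 $v\mapsto v^{[r]}$; $S=\kappa[\pi|_M]$; $R_0=\kappa[\pi^m|_M]$; $R=\operatorname{Cent}_E(R_0)$ (centralizer); $L=\mathbb F_{q^m}\subseteq R$ acting on $M$ by scalar multiplication. Rank weight: multiplication $L\otimes_{\mathbb F_q}S\to R$ is bijective, and $\dim_{\mathbb F_q}S=nd$. Fix an $\mathbb F_q$-basis $(s_j)_{1\le j\le nd}$ of $S$; every $f\in R$ is uniquely $f=\sum_jb_js_j$ with $b_j\in L$, and $\operatorname{wt}(f)=\dim_{\mathbb F_q}\langle b_1,\dots,b_{nd}\rangle_{\mathbb F_q}$. This is independent of the basis and equals $\min\{\dim_{\mathbb F_q}V: V\subseteq L \text{ an } \mathbb F_q\text{-subspace},\ f\in V\cdot S\}$, where $V\cdot S$ is the $\mathbb F_q$-span of the products $vs$, $v\in V$, $s\in S$. $S$-normality: $\alpha\in M$ is $S$-normal if $\alpha,\alpha^{[r]},\dots,\alpha^{[r(n-1)]}$ is a $\kappa$-basis of $M$; equivalently, the evaluation map $S\to M$, $x\mapsto x(\alpha)$, is bijective. *)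

theory Defs
  imports
    "HOL-Algebra.Algebraic_Closure_Type"
    "HOL-Algebra.Generated_Rings"
    "HOL-Library.Function_Algebras"
    "HOL-Library.FuncSet"
    "HOL-Library.Cardinality"
begin

text \<open>
  The base field \<open>\<bbbF>\<^sub>q\<close> is an arbitrary type \<open>'a :: finite_field\<close>, so that \<open>q = CARD('a)\<close>;
  \<open>A = \<bbbF>\<^sub>q[T]\<close> is \<open>'a poly\<close>, and the fixed algebraic closure is \<open>'a alg_closure\<close>,
  into which \<open>\<bbbF>\<^sub>q\<close> embeds by \<^const>\<open>to_ac\<close>.
\<close>

text \<open>The subfield with \<open>q\<^sup>k\<close> elements of the algebraic closure (meant for \<open>k \<ge> 1\<close>).\<close>

definition Fq_ext :: "nat \<Rightarrow> 'a::finite_field alg_closure set" where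
  "Fq_ext k = {x. x ^ (CARD('a) ^ k) = x}"


subsection \<open>Twisted polynomials and the Drinfeld module\<close>

text \<open>
  A twisted polynomial \<open>\<Sum> c\<^sub>i \<tau>\<^sup>i\<close> is stored through its coefficient sequence as an ordinary
  polynomial; only the multiplication differs:
  \<open>(a \<tau>\<^sup>i) (b \<tau>\<^sup>j) = a b^(q^i) \<tau>^(i+j)\<close>.
\<close>

definition twisted_mult ::
    "'a::finite_field alg_closure poly \<Rightarrow> 'a alg_closure poly \<Rightarrow> 'a alg_closure poly" where
  "twisted_mult f g =
     (\<Sum>i\<le>Polynomial.degree f. \<Sum>j\<le>Polynomial.degree g.
        Polynomial.monom (poly.coeff f i * poly.coeff g j ^ (CARD('a) ^ i)) (i + j))"

definition twisted_poly_ring :: "nat \<Rightarrow> 'a::finite_field alg_closure poly ring" where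
  "twisted_poly_ring r =
     \<lparr>carrier = {f. \<forall>i. poly.coeff f i \<in> Fq_ext r},
      monoid.mult = twisted_mult, one = 1, ring.zero = 0, add = (+)\<rparr>"

definition twisted_eval :: "'a::finite_field alg_closure poly \<Rightarrow> 'a alg_closure \<Rightarrow> 'a alg_closure" where
  "twisted_eval f v = (\<Sum>i\<le>Polynomial.degree f. poly.coeff f i * v ^ (CARD('a) ^ i))"

definition drinfeld_T :: "'a::finite_field alg_closure \<Rightarrow> nat \<Rightarrow> 'a alg_closure poly" where
  "drinfeld_T t n = [:t:] + Polynomial.monom 1 n"

text \<open>The \<open>\<bbbF>\<^sub>q\<close>-algebra homomorphism \<open>a \<mapsto> \<phi>\<^sub>a\<close> into \<open>\<bbbF>{\<tau>}\<close> (coefficients in \<^term>\<open>Fq_ext r\<close>)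
  determined by \<open>\<phi>\<^sub>T = t + \<tau>\<^sup>n\<close>.\<close>

definition drinfeld ::
    "nat \<Rightarrow> 'a::finite_field alg_closure \<Rightarrow> nat \<Rightarrow> 'a poly \<Rightarrow> 'a alg_closure poly" where
  "drinfeld r t n a =
     (\<Sum>i\<le>Polynomial.degree a.
        Polynomial.smult (to_ac (poly.coeff a i)) (drinfeld_T t n [^]\<^bsub>twisted_poly_ring r\<^esub> i))"

definition torsion ::
    "nat \<Rightarrow> 'a::finite_field alg_closure \<Rightarrow> nat \<Rightarrow> 'a poly \<Rightarrow> 'a alg_closure set" where
  "torsion r t n p = {v. twisted_eval (drinfeld r t n p) v = 0}"


subsection \<open>Endomorphisms of the torsion module\<close>

text \<open>
  Maps \<open>M \<rightarrow> M\<close> are represented as functions on the whole algebraic closure that vanish outside \<open>M\<close>,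
  which makes the representation unique and lets pointwise addition and composition be used directly.
\<close>

definition on_set :: "'b set \<Rightarrow> ('b \<Rightarrow> 'b) \<Rightarrow> 'b \<Rightarrow> 'b::zero" where
  "on_set M g = (\<lambda>v. if v \<in> M then g v else 0)"

text \<open>
  The ring \<open>E = End\<^sub>\<kappa>(M)\<close>, \<open>\<kappa> = A/\<pp>\<close>. The class of \<open>a\<close> acts on \<open>M\<close> as \<open>\<phi>\<^sub>a\<close>, hence \<open>\<kappa>\<close>-linear means
  additive and commuting with all \<open>\<phi>\<^sub>a\<close>.
\<close>

definition End_kappa ::
    "nat \<Rightarrow> 'a::finite_field alg_closure \<Rightarrow> nat \<Rightarrow> 'a poly \<Rightarrow> ('a alg_closure \<Rightarrow> 'a alg_closure) ring" where
  "End_kappa r t n p = (let M = torsion r t n p in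
     \<lparr>carrier = {f. f \<in> M \<rightarrow> M \<and> (\<forall>v. v \<notin> M \<longrightarrow> f v = 0) \<and>
                    (\<forall>u\<in>M. \<forall>v\<in>M. f (u + v) = f u + f v) \<and>
                    (\<forall>a. \<forall>v\<in>M. f (twisted_eval (drinfeld r t n a) v)
                              = twisted_eval (drinfeld r t n a) (f v))},
      monoid.mult = (\<circ>), one = on_set M (\<lambda>v. v), ring.zero = (\<lambda>_. 0), add = (+)\<rparr>)"

text \<open>The image of \<open>\<kappa>\<close> in \<open>E\<close>.\<close>

definition kappa_maps ::
    "nat \<Rightarrow> 'a::finite_field alg_closure \<Rightarrow> nat \<Rightarrow> 'a poly \<Rightarrow> ('a alg_closure \<Rightarrow> 'a alg_closure) set" where
  "kappa_maps r t n p =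
     range (\<lambda>a. on_set (torsion r t n p) (twisted_eval (drinfeld r t n a)))"

text \<open>The restriction of \<open>\<pi> = \<tau>\<^sup>r\<close> to \<open>M\<close>.\<close>

definition frob ::
    "nat \<Rightarrow> 'a::finite_field alg_closure \<Rightarrow> nat \<Rightarrow> 'a poly \<Rightarrow> 'a alg_closure \<Rightarrow> 'a alg_closure" where
  "frob r t n p = on_set (torsion r t n p) (\<lambda>v. v ^ (CARD('a) ^ r))"

definition S_ring ::
    "nat \<Rightarrow> 'a::finite_field alg_closure \<Rightarrow> nat \<Rightarrow> 'a poly \<Rightarrow> ('a alg_closure \<Rightarrow> 'a alg_closure) set" where
  "S_ring r t n p =
     generate_ring (End_kappa r t n p) (insert (frob r t n p) (kappa_maps r t n p))"

definition R0_ring ::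
    "nat \<Rightarrow> 'a::finite_field alg_closure \<Rightarrow> nat \<Rightarrow> 'a poly \<Rightarrow> nat \<Rightarrow>
     ('a alg_closure \<Rightarrow> 'a alg_closure) set" where
  "R0_ring r t n p m =
     generate_ring (End_kappa r t n p)
       (insert (frob r t n p [^]\<^bsub>End_kappa r t n p\<^esub> m) (kappa_maps r t n p))"

definition centralizer :: "('b, 'c) monoid_scheme \<Rightarrow> 'b set \<Rightarrow> 'b set" where
  "centralizer G B = {f \<in> carrier G. \<forall>g\<in>B. f \<otimes>\<^bsub>G\<^esub> g = g \<otimes>\<^bsub>G\<^esub> f}"

definition R_ring ::
    "nat \<Rightarrow> 'a::finite_field alg_closure \<Rightarrow> nat \<Rightarrow> 'a poly \<Rightarrow> nat \<Rightarrow>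
     ('a alg_closure \<Rightarrow> 'a alg_closure) set" where
  "R_ring r t n p m = centralizer (End_kappa r t n p) (R0_ring r t n p m)"


subsection \<open>Rank weight\<close>

definition fq_scale :: "'a::finite_field \<Rightarrow> 'a alg_closure \<Rightarrow> 'a alg_closure" where
  "fq_scale c x = to_ac c * x"

definition fq_scale_fun ::
    "'a::finite_field \<Rightarrow> ('b \<Rightarrow> 'a alg_closure) \<Rightarrow> 'b \<Rightarrow> 'a alg_closure" where
  "fq_scale_fun c g = (\<lambda>v. fq_scale c (g v))"

interpretation fq: vector_space "fq_scale :: 'a::finite_field \<Rightarrow> _"
  by unfold_locales (simp_all add: fq_scale_def algebra_simps)

interpretation fq_fun: vector_space "fq_scale_fun :: 'a::finite_field \<Rightarrow> ('b \<Rightarrow> _) \<Rightarrow> _"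
  by unfold_locales (simp_all add: fq_scale_fun_def fq_scale_def fun_eq_iff algebra_simps)

definition is_fq_basis ::
    "nat \<Rightarrow> (nat \<Rightarrow> 'b \<Rightarrow> 'a::finite_field alg_closure) \<Rightarrow> ('b \<Rightarrow> 'a alg_closure) set \<Rightarrow> bool" where
  "is_fq_basis N s V \<longleftrightarrow>
     inj_on s {..<N} \<and> fq_fun.independent (s ` {..<N}) \<and> fq_fun.span (s ` {..<N}) = V"

text \<open>
  The coordinates \<open>b\<^sub>j \<in> L = Fq_ext m\<close> in \<open>f = \<Sum> b\<^sub>j s\<^sub>j\<close>, with \<open>L\<close> acting by scalar multiplication;
  they exist uniquely when \<open>f \<in> R\<close> and \<open>s\<close> is an \<open>\<bbbF>\<^sub>q\<close>-basis of \<open>S\<close>.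
\<close>

definition L_coords ::
    "nat \<Rightarrow> nat \<Rightarrow> (nat \<Rightarrow> 'a::finite_field alg_closure \<Rightarrow> 'a alg_closure) \<Rightarrow>
     ('a alg_closure \<Rightarrow> 'a alg_closure) \<Rightarrow> nat \<Rightarrow> 'a alg_closure" where
  "L_coords m N s f =
     (THE b. b \<in> {..<N} \<rightarrow>\<^sub>E Fq_ext m \<and> f = (\<lambda>v. \<Sum>j<N. b j * s j v))"

definition rank_wt ::
    "nat \<Rightarrow> nat \<Rightarrow> (nat \<Rightarrow> 'a::finite_field alg_closure \<Rightarrow> 'a alg_closure) \<Rightarrow>
     ('a alg_closure \<Rightarrow> 'a alg_closure) \<Rightarrow> nat" where
  "rank_wt m N s f = fq.dim (fq.span (L_coords m N s f ` {..<N}))"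


subsection \<open>Normality\<close>

text \<open>
  \<open>w\<^sub>0, \<dots>, w\<^sub>N\<^sub>-\<^sub>1\<close> is a \<open>\<kappa>\<close>-basis of \<open>M\<close>. Scalars from \<open>\<kappa> = A/\<pp>\<close> are given by representatives in \<open>A\<close>:
  a scalar vanishes iff \<open>\<pp>\<close> divides its representative.
\<close>

definition is_kappa_basis ::
    "nat \<Rightarrow> 'a::finite_field alg_closure \<Rightarrow> nat \<Rightarrow> 'a poly \<Rightarrow> nat \<Rightarrow> (nat \<Rightarrow> 'a alg_closure) \<Rightarrow> bool" where
  "is_kappa_basis r t n p N w \<longleftrightarrow>
     (\<forall>i<N. w i \<in> torsion r t n p) \<and>
     (\<forall>c. (\<Sum>i<N. twisted_eval (drinfeld r t n (c i)) (w i)) = 0 \<longrightarrow> (\<forall>i<N. p dvd c i)) \<and>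
     (\<forall>v\<in>torsion r t n p. \<exists>c. v = (\<Sum>i<N. twisted_eval (drinfeld r t n (c i)) (w i)))"

definition S_normal ::
    "nat \<Rightarrow> 'a::finite_field alg_closure \<Rightarrow> nat \<Rightarrow> 'a poly \<Rightarrow> 'a alg_closure \<Rightarrow> bool" where
  "S_normal r t n p \<alpha> \<longleftrightarrow>
     \<alpha> \<in> torsion r t n p \<and> is_kappa_basis r t n p n (\<lambda>i. \<alpha> ^ (CARD('a) ^ (r * i)))"

end

theory Submission
  imports Defs
begin

text \<open>
  The statement is a BCH bound for the rank metric. Write \<open>M = \<phi>[\<pp>]\<close>, \<open>\<pi>\<close> for the \<open>q\<^sup>r\<close>-power Frobenius on
  \<open>M\<close>, \<open>S = \<kappa>[\<pi>]\<close> and \<open>L = \<bbbF>\<^bsub>q^m\<^esub>\<close>. Suppose that \<open>f = \<Sum> b\<^sub>j s\<^sub>j\<close> with \<open>b\<^sub>j \<in> L\<close> and that the \<open>b\<^sub>j\<close> span a space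
  of dimension \<open>w\<close> over \<open>\<bbbF>\<^sub>q\<close> with basis \<open>v\<^sub>1, \<dots>, v\<^sub>w\<close>. Then \<open>f = \<Sum> v\<^sub>k x\<^sub>k\<close> with \<open>x\<^sub>k \<in> S\<close>. If \<open>f\<close> vanishes at
  \<open>\<pi>\<^sup>i \<alpha>\<close> for all \<open>i < w\<close>, the equations \<open>\<Sum> v\<^sub>k \<pi>\<^sup>i(x\<^sub>k \<alpha>) = 0\<close> become, after applying suitable powers of
  \<open>\<pi>\<close>, a square system for the elements \<open>\<pi>\<^bsup>w-1\<^esup>(x\<^sub>k \<alpha>)\<close> whose matrix is the Moore matrix of the \<open>v\<^sub>k\<close>.
  As \<open>r\<close> is prime to \<open>m\<close>, the Frobenius of exponent \<open>q\<^sup>r\<close> generates the Galois group of \<open>L\<close> over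
  \<open>\<bbbF>\<^sub>q\<close>, so this matrix is invertible (\<open>moore_kernel_trivial\<close>). Hence \<open>x\<^sub>k \<alpha> = 0\<close>, and \<open>x\<^sub>k = 0\<close> because \<open>\<alpha>\<close>
  generates \<open>M\<close> over \<open>S\<close>. So a nonzero \<open>f\<close> of weight \<open>w\<close> is nonzero at one of \<open>\<alpha>, \<dots>, \<pi>\<^bsup>w-1\<^esup> \<alpha>\<close>
  (\<open>coordinates_vanish\<close>, \<open>nonzero_at_conjugate_below_rank_wt\<close>).

  The weight is read off from coordinates given by a definite description, so the bijectivity of
  \<open>L \<otimes> S \<rightarrow> R\<close> is part of the proof. Injectivity is again \<open>coordinates_vanish\<close>. For surjectivity, \<open>S\<close> is
  identified with the full commutant of \<open>\<pi>\<close> (\<open>S_eq_commutant\<close>), again by cyclicity of \<open>M\<close>. Conjugation by \<open>\<pi>\<close>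
  acts on \<open>R\<close> with \<open>m\<close>-th power the identity and semilinearly over \<open>L\<close>; Galois descent
  (\<open>galois_descent\<close>) then writes every element of \<open>R\<close> as an \<open>L\<close>-combination of elements fixed by the
  conjugation, which are those of \<open>S\<close>.
\<close>

section \<open>Frobenius powers on the algebraic closure of a finite field\<close>

text \<open>
  Both \<open>(1 + X)\<^sup>q\<close> and \<open>1 + X\<^sup>q\<close> are monic of degree \<open>q\<close> and take the value \<open>1 + a\<close> at each of the
  \<open>q\<close> elements \<open>a\<close> of the field, so they are the same polynomial. This gives additivity of \<open>x \<mapsto> x\<^sup>q\<close>
  without writing \<open>q\<close> as a power of the characteristic.
\<close>
lemma binomial_card_eq_0:
  assumes "0 < k" "k < CARD('a::finite_field)"
  shows "of_nat (CARD('a) choose k) = (0 :: 'a)"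
proof -
  let ?q = "CARD('a)"
  have "[:1, 1:] ^ ?q = (1 + Polynomial.monom 1 ?q :: 'a poly)"
  proof (rule poly_eqI_degree_lead_coeff[where n = ?q and A = UNIV])
    show "poly.coeff ([:1, 1:] ^ ?q) ?q = poly.coeff (1 + Polynomial.monom 1 ?q :: 'a poly) ?q"
      using finite_UNIV_card_ge_0[where ?'a='a] by (simp add: coeff_linear_poly_power)
    show "Polynomial.degree ([:1, 1:] ^ ?q :: 'a poly) \<le> ?q"
      using degree_power_le[of "[:1, 1:] :: 'a poly" ?q] by simp
    show "Polynomial.degree (1 + Polynomial.monom 1 ?q :: 'a poly) \<le> ?q"
      by (intro degree_add_le degree_monom_le) auto
    show "poly ([:1, 1:] ^ ?q) z = poly (1 + Polynomial.monom 1 ?q) z" for z :: 'a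
      by (simp add: poly_monom finite_field_power_card_eq_same)
  qed auto
  hence "poly.coeff ([:1, 1:] ^ ?q) k = poly.coeff (1 + Polynomial.monom 1 ?q :: 'a poly) k"
    by simp
  thus ?thesis using assms by (simp add: coeff_linear_poly_power)
qed

lemma frobenius_add:
  fixes x y :: "'a::finite_field alg_closure"
  shows "(x + y) ^ (CARD('a) ^ k) = x ^ (CARD('a) ^ k) + y ^ (CARD('a) ^ k)"
proof -
  have q: "(x + y) ^ CARD('a) = x ^ CARD('a) + y ^ CARD('a)" for x y :: "'a alg_closure"
  proof -
    let ?g = "\<lambda>k. of_nat (CARD('a) choose k) * x ^ k * y ^ (CARD('a) - k)"
    have "?g k = 0" if "0 < k" "k < CARD('a)" for k
    proof -
      have "of_nat (CARD('a) choose k) = to_ac (of_nat (CARD('a) choose k) :: 'a)"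
        by (rule to_ac_of_nat [symmetric])
      thus ?thesis using binomial_card_eq_0[OF that] by simp
    qed
    hence "(\<Sum>k\<le>CARD('a). ?g k) = (\<Sum>k\<in>{0, CARD('a)}. ?g k)"
      by (intro sum.mono_neutral_right) auto
    thus ?thesis
      using finite_UNIV_card_ge_0[where ?'a='a] by (simp add: binomial_ring add.commute)
  qed
  show ?thesis
    by (induction k arbitrary: x y) (simp_all add: power_mult q)
qed

lemma frobenius_sum:
  fixes g :: "'b \<Rightarrow> 'a::finite_field alg_closure"
  shows "(\<Sum>i\<in>A. g i) ^ (CARD('a) ^ k) = (\<Sum>i\<in>A. g i ^ (CARD('a) ^ k))"
  by (induction A rule: infinite_finite_induct) (simp_all add: frobenius_add zero_power)

lemma frobenius_minus:
  fixes x :: "'a::finite_field alg_closure"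
  shows "(- x) ^ (CARD('a) ^ k) = - (x ^ (CARD('a) ^ k))"
  using frobenius_add[of x "-x" k] by (simp add: eq_neg_iff_add_eq_0 zero_power add.commute)

lemma frobenius_diff:
  fixes x y :: "'a::finite_field alg_closure"
  shows "(x - y) ^ (CARD('a) ^ k) = x ^ (CARD('a) ^ k) - y ^ (CARD('a) ^ k)"
  using frobenius_add[of x "-y" k] by (simp add: frobenius_minus)

lemma frobenius_to_ac [simp]:
  "to_ac (c :: 'a::finite_field) ^ (CARD('a) ^ k) = to_ac c"
  by (metis finite_field_power_card_power_eq_same to_ac_power)

lemma frobenius_bij: "bij (\<lambda>x :: 'a::finite_field alg_closure. x ^ (CARD('a) ^ k))"
proof (intro bijI injI surjI)
  fix x y :: "'a alg_closure"
  assume "x ^ (CARD('a) ^ k) = y ^ (CARD('a) ^ k)"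
  hence "(x - y) ^ (CARD('a) ^ k) = 0" by (simp add: frobenius_diff)
  thus "x = y" by simp
next
  show "(SOME z. z ^ (CARD('a) ^ k) = y) ^ (CARD('a) ^ k) = y" for y :: "'a alg_closure"
    by (rule someI_ex, rule nth_root_exists) simp
qed

lemma Fq_ext_closed:
  fixes x y :: "'a::finite_field alg_closure"
  assumes "x \<in> Fq_ext k" "y \<in> Fq_ext k"
  shows "x + y \<in> Fq_ext k" "x - y \<in> Fq_ext k" "x * y \<in> Fq_ext k" "x / y \<in> Fq_ext k"
    "x ^ i \<in> Fq_ext k"
proof -
  have "(x ^ i) ^ (CARD('a) ^ k) = (x ^ (CARD('a) ^ k)) ^ i"
    by (metis mult.commute power_mult)
  then show "x + y \<in> Fq_ext k" "x - y \<in> Fq_ext k" "x * y \<in> Fq_ext k" "x / y \<in> Fq_ext k"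
    "x ^ i \<in> Fq_ext k"
    using assms 
    by (simp_all add: Fq_ext_def frobenius_add frobenius_diff power_mult_distrib power_divide)
qed

lemma to_ac_in_Fq_ext [simp]: "to_ac c \<in> Fq_ext k"
  by (simp add: Fq_ext_def)

lemma Fq_ext_sum:
  "(\<And>i. i \<in> A \<Longrightarrow> g i \<in> Fq_ext k) \<Longrightarrow> (\<Sum>i\<in>A. g i) \<in> Fq_ext k"
  by (simp add: Fq_ext_def frobenius_sum)

lemma Fq_ext_frobenius_multiple:
  assumes "(x :: 'a::finite_field alg_closure) \<in> Fq_ext k"
  shows "x ^ (CARD('a) ^ (k * j)) = x"
  using assms by (induction j) (simp_all add: Fq_ext_def power_add power_mult)

text \<open>\<open>X\<^bsup>N\<^esup> - X\<close> with \<open>N = q\<^sup>k\<close> has derivative \<open>-1\<close>, so its \<open>N\<close> roots are distinct.\<close>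
lemma card_Fq_ext:
  assumes "k > 0"
  shows "card (Fq_ext k :: 'a::finite_field alg_closure set) = CARD('a) ^ k"
    and "finite (Fq_ext k :: 'a::finite_field alg_closure set)"
proof -
  let ?N = "CARD('a) ^ k"
  define P where "P = (Polynomial.monom 1 ?N - [:0, 1:] :: 'a alg_closure poly)"
  have q: "CARD('a) > 1"
    using card_mono[of UNIV "{0, 1 :: 'a}"] by simp
  have N: "?N > 1" using one_less_power[OF q assms] .
  have cf: "poly.coeff P ?N = 1"
    using N assms by (auto simp: P_def coeff_pCons split: nat.splits)
  hence P0: "P \<noteq> 0"
    by (metis coeff_0 zero_neq_one)
  have eq: "Fq_ext k = {x. poly P x = 0}"
    by (auto simp: Fq_ext_def poly_monom P_def)
  show fin: "finite (Fq_ext k :: 'a alg_closure set)"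
    unfolding eq using P0 by (rule poly_roots_finite)
  have "of_nat CARD('a) = (0 :: 'a alg_closure)"
    using binomial_card_eq_0[where ?'a='a, of 1] q by (metis choose_one less_numeral_extra(1) to_ac_0 to_ac_of_nat)
  hence N0: "of_nat ?N = (0 :: 'a alg_closure)"
    using assms by (simp add: zero_power)
  have pd: "pderiv P = [:-1:]"
    unfolding P_def by (simp only: pderiv_diff pderiv_monom N0) (simp add: pderiv_pCons)
  obtain A where A: "size A = Polynomial.degree P"
      "P = Polynomial.smult (lead_coeff P) (\<Prod>x\<in>#A. [:-x, 1:])"
    using alg_closed_imp_factorization[OF P0] by blast
  have "count A x \<le> 1" for x
  proof (rule ccontr)
    assume "\<not> count A x \<le> 1"
    hence "{#x, x#} \<subseteq># A"
      by (auto simp: subseteq_mset_def)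
    then obtain B where "A = {#x, x#} + B"
      by (metis subset_mset.le_iff_add)
    hence "P = [:-x, 1:] * ([:-x, 1:] * Polynomial.smult (lead_coeff P) (\<Prod>x\<in>#B. [:-x, 1:]))"
      using A(2) by (metis (no_types, lifting) add_mset_add_single image_mset_add_mset 
            mult_smult_right prod_mset.add_mset union_mset_add_mset_left add_0)
    then obtain G where "P = [:-x, 1:] * ([:-x, 1:] * G)" by blast
    hence "poly (pderiv P) x = 0" by (simp add: pderiv_mult del: mult_pCons_left)
    thus False by (simp add: pd)
  qed
  hence "A = mset_set (set_mset A)"
    by (intro multiset_eqI) (metis count_mset_set(1) count_mset_set(3) count_eq_zero_iff 
         finite_set_mset le_antisym  One_nat_def not_gr0 Suc_leI)
  hence "card (set_mset A) = Polynomial.degree P"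
    using A(1) by (metis size_mset_set)
  moreover have "Polynomial.degree P \<ge> ?N"
    using cf by (intro le_degree) simp
  moreover have "set_mset A \<subseteq> Fq_ext k"
  proof
    fix x assume "x \<in># A"
    hence "poly (\<Prod>x\<in>#A. [:-x, 1:]) x = 0"
      by (induction A) auto
    thus "x \<in> Fq_ext k" unfolding eq by (subst A(2)) simp
  qed
  ultimately have "card (Fq_ext k :: 'a::finite_field alg_closure set) \<ge> ?N"
    using card_mono[OF fin] by (metis order_trans)
  moreover have "card (Fq_ext k :: 'a alg_closure set) \<le> Polynomial.degree P"
    unfolding eq using P0 by (rule card_poly_roots_bound)
  moreover have "Polynomial.degree P \<le> ?N"
    unfolding P_def using N by (intro degree_diff_le degree_monom_le) auto
  ultimately show "card (Fq_ext k :: 'a::finite_field alg_closure set) = ?N" by linarith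
qed

lemma Fq_ext_1: "Fq_ext 1 = range (to_ac :: 'a::finite_field \<Rightarrow> _)"
proof (rule card_subset_eq[symmetric])
  show "card (range (to_ac :: 'a \<Rightarrow> _)) = card (Fq_ext 1 :: 'a alg_closure set)"
    by (simp add: card_image inj_to_ac card_Fq_ext)
qed (auto simp: card_Fq_ext)

text \<open>
  The Galois group of the field with \<open>q\<^sup>m\<close> elements is cyclic of order \<open>m\<close>, so the \<open>r\<close>-th power of its
  Frobenius generator is again a generator when \<open>r\<close> is prime to \<open>m\<close>, and has fixed field \<open>\<bbbF>\<^sub>q\<close>.
  Concretely, a Bezout relation \<open>m a = r b + 1\<close> turns the two equations for \<open>x\<close> into \<open>x\<^sup>q = x\<close>.
\<close>
lemma Fq_ext_frobenius_fixed:
  fixes x :: "'a::finite_field alg_closure"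
  assumes "m > 0" "coprime m r" "x \<in> Fq_ext m" "x ^ (CARD('a) ^ r) = x"
  shows "x \<in> range to_ac"
proof -
  obtain a b where ab: "m * a = r * b + gcd m r"
    using bezout_nat[of m r] assms by auto
  have "x = x ^ (CARD('a) ^ (r * b + 1))"
    using ab Fq_ext_frobenius_multiple[OF assms(3), of a] assms(2) by simp
  also have "\<dots> = (x ^ (CARD('a) ^ (r * b))) ^ CARD('a)"
    by (simp add: power_mult[symmetric] mult.commute)
  also have "\<dots> = x ^ CARD('a)"
    using assms(4) Fq_ext_frobenius_multiple[of x r b] by (simp add: Fq_ext_def)
  finally show ?thesis
    unfolding Fq_ext_1[symmetric] by (simp add: Fq_ext_def)
qed

section \<open>Moore systems and Galois descent\<close>

text \<open>
  This is the invertibility of the Moore matrix of \<open>w\<close> elements of \<open>\<bbbF>\<^bsub>q^m\<^esub>\<close> that are independent over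
  \<open>\<bbbF>\<^sub>q\<close>, for the automorphism \<open>x \<mapsto> x\<^bsup>q^r\<^esup>\<close>. The induction step is Gaussian elimination: after dividing
  by one of the elements, the difference of two consecutive equations is a system of the same shape
  in one unknown less, whose coefficients \<open>u\<^bsup>q^r\<^esup> - u\<close> are still independent because the kernel
  of \<open>u \<mapsto> u\<^bsup>q^r\<^esup> - u\<close> on \<open>\<bbbF>\<^bsub>q^m\<^esub>\<close> is \<open>\<bbbF>\<^sub>q\<close>.
\<close>
lemma moore_kernel_trivial:
  fixes v z :: "nat \<Rightarrow> 'a::finite_field alg_closure"
  assumes m: "m > 0" "coprime m r"
    and v: "\<And>k. k < w \<Longrightarrow> v k \<in> Fq_ext m"
    and indep: "\<And>c :: nat \<Rightarrow> 'a. (\<Sum>k<w. to_ac (c k) * v k) = 0 \<Longrightarrow> \<forall>k<w. c k = 0"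
    and eqs: "\<And>j. j < w \<Longrightarrow> (\<Sum>k<w. v k ^ ((CARD('a) ^ r) ^ j) * z k) = 0"
  shows "\<forall>k<w. z k = 0"
  using v indep eqs
proof (induction w arbitrary: v)
  case 0
  then show ?case by simp
next
  case (Suc w)
  let ?Q = "CARD('a) ^ r"
  have frob: "(\<Sum>k\<in>A. g k) ^ ?Q = (\<Sum>k\<in>A. g k ^ ?Q)" for A :: "nat set" and g :: "nat \<Rightarrow> 'a alg_closure"
    by (rule frobenius_sum)
  have vw: "v w \<noteq> 0"
  proof
    assume "v w = 0"
    hence "(\<Sum>k<Suc w. to_ac (if k = w then 1 else 0 :: 'a) * v k) = 0"
      by (intro sum.neutral) auto
    from Suc.prems(2)[OF this] show False by auto
  qed
  define u where "u k = v k / v w" for k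
  define u' where "u' k = u k ^ ?Q - u k" for k
  have uL: "u k \<in> Fq_ext m" if "k < Suc w" for k
    unfolding u_def using Suc.prems(1) that by (intro Fq_ext_closed) auto
  have eqs_u: "(\<Sum>k<Suc w. u k ^ (?Q ^ j) * z k) = 0" if "j < Suc w" for j
  proof -
    have "(\<Sum>k<Suc w. u k ^ (?Q ^ j) * z k) = (\<Sum>k<Suc w. v k ^ (?Q ^ j) * z k) / v w ^ (?Q ^ j)"
      by (simp only: u_def power_divide sum_divide_distrib) (simp add: field_simps)
    thus ?thesis using Suc.prems(3)[OF that] by simp
  qed
  have "\<forall>k<w. z k = 0"
  proof (rule Suc.IH)
    show "u' k \<in> Fq_ext m" if "k < w" for k
      unfolding u'_def using uL that by (intro Fq_ext_closed) auto
  next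
    fix c :: "nat \<Rightarrow> 'a"
    assume c: "(\<Sum>k<w. to_ac (c k) * u' k) = 0"
    define x where "x = (\<Sum>k<w. to_ac (c k) * u k)"
    have "x ^ ?Q = (\<Sum>k<w. to_ac (c k) * u k ^ ?Q)"
      unfolding x_def frob by (simp add: power_mult_distrib)
    hence "x ^ ?Q - x = 0"
      using c by (simp add: x_def u'_def algebra_simps sum_subtractf)
    moreover have "x \<in> Fq_ext m"
      unfolding x_def using uL by (intro Fq_ext_sum Fq_ext_closed) auto
    ultimately have "x \<in> range to_ac"
      using Fq_ext_frobenius_fixed[OF m] by simp
    then obtain a where a: "x = to_ac a" by blast
    \<comment> \<open>The relation \<open>x = a\<close> says that \<open>v w\<close> depends on the other \<open>v k\<close>, unless all \<open>c k\<close> vanish.\<close>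
    have "(\<Sum>k<Suc w. to_ac ((c(w := - a)) k) * v k) = (x - to_ac a) * v w"
      using vw by (simp add: x_def u_def sum_distrib_right left_diff_distrib)
    also have "\<dots> = 0" by (simp add: a)
    finally show "\<forall>k<w. c k = 0"
      using Suc.prems(2) by (metis fun_upd_apply less_Suc_eq nat_neq_iff)
  next
    fix j assume j: "j < w"
    have "(\<Sum>k<w. u' k ^ (?Q ^ j) * z k)
        = (\<Sum>k<Suc w. u k ^ (?Q ^ Suc j) * z k) - (\<Sum>k<Suc w. u k ^ (?Q ^ j) * z k)"
    proof -
      have "u' k ^ (?Q ^ j) = u k ^ (?Q ^ Suc j) - u k ^ (?Q ^ j)" for k
        using frobenius_diff[of "u k ^ ?Q" "u k" "r * j"]
        by (simp add: u'_def power_mult[symmetric] )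
      moreover have "u w = 1" using vw by (simp add: u_def)
      ultimately show ?thesis
        by (simp add: left_diff_distrib sum_subtractf del: power_Suc)
    qed
    thus "(\<Sum>k<w. u' k ^ (?Q ^ j) * z k) = 0"
      using eqs_u[of j] eqs_u[of "Suc j"] j by simp
  qed
  moreover from this have "z w = 0"
    using Suc.prems(3)[of 0] vw by simp
  ultimately show ?case by (simp add: less_Suc_eq)
qed

text \<open>
  On \<open>\<bbbF>\<^bsub>q^m\<^esub>\<close> the map \<open>x \<mapsto> x\<^bsup>q^(rj)\<^esup>\<close> agrees with \<open>x \<mapsto> x\<^bsup>q^e\<^esup>\<close> for \<open>e = r j mod m\<close>, and \<open>0 < e < m\<close>. If it
  were the identity, then all \<open>q\<^sup>m\<close> elements would lie in the field with only \<open>q\<^sup>e\<close> elements.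
\<close>
lemma frobenius_moves:
  assumes m: "m > 0" "coprime m r" and j: "0 < j" "j < m"
  shows "\<exists>x \<in> Fq_ext m. x ^ ((CARD('a) ^ r) ^ j) \<noteq> (x :: 'a::finite_field alg_closure)"
proof (rule ccontr)
  assume "\<not> ?thesis"
  hence fixed: "x ^ (CARD('a) ^ (r * j)) = x" if "x \<in> Fq_ext m" for x :: "'a alg_closure"
    using that by (auto simp: power_mult)
  define e where "e = (r * j) mod m"
  have "\<not> m dvd r * j"
    using m j by (metis coprime_dvd_mult_right_iff nat_dvd_not_less)
  hence e: "0 < e" "e < m" using m by (auto simp: e_def dvd_eq_mod_eq_0)
  have "x \<in> Fq_ext e" if "x \<in> Fq_ext m" for x :: "'a alg_closure"
  proof -
    have "r * j = m * (r * j div m) + e" by (simp add: e_def)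
    hence "x ^ (CARD('a) ^ (r * j)) = (x ^ (CARD('a) ^ (m * (r * j div m)))) ^ (CARD('a) ^ e)"
      by (metis power_add power_mult)
    thus ?thesis
      using fixed[OF that] Fq_ext_frobenius_multiple[OF that] by (simp add: Fq_ext_def)
  qed
  hence "card (Fq_ext m :: 'a alg_closure set) \<le> card (Fq_ext e :: 'a alg_closure set)"
    using card_Fq_ext(2)[OF e(1)] by (intro card_mono) auto
  moreover have "CARD('a) > 1"
    using card_mono[of UNIV "{0, 1 :: 'a}"] by simp
  ultimately show False
    using e m(1) by (simp add: card_Fq_ext)
qed

text \<open>
  Write \<open>\<sigma>\<close> for \<open>x \<mapsto> x\<^bsup>q^r\<^esup>\<close>. If the functions \<open>g\<^sub>i\<close> are the conjugates of \<open>g\<^sub>0\<close> under a semilinear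
  action, the sums in the hypothesis are the traces of the multiples \<open>c g\<^sub>0\<close>; the conclusion says
  that \<open>g\<^sub>0\<close> is a combination of such traces with coefficients in \<open>\<bbbF>\<^bsub>q^m\<^esub>\<close>. Choose \<open>x\<^sub>j\<close> with \<open>\<sigma>\<^sup>j x\<^sub>j \<noteq> x\<^sub>j\<close>.
  Replacing \<open>c\<close> by \<open>c x\<^sub>j\<close> and subtracting \<open>\<sigma>\<^sup>j x\<^sub>j\<close> times the original sum multiplies the
  coefficient of \<open>g\<^sub>i\<close> by \<open>\<sigma>\<^sup>i x\<^sub>j - \<sigma>\<^sup>j x\<^sub>j\<close>, which kills \<open>g\<^sub>j\<close> and keeps \<open>g\<^sub>0\<close>. Doing this for all
  \<open>0 < j < m\<close> isolates \<open>g\<^sub>0\<close>.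
\<close>
lemma galois_descent:
  fixes g :: "nat \<Rightarrow> 'b \<Rightarrow> 'a::finite_field alg_closure"
  assumes m: "m > 0" "coprime m r"
    and add: "\<And>x y. x \<in> W \<Longrightarrow> y \<in> W \<Longrightarrow> x + y \<in> W"
    and scale: "\<And>c x. c \<in> Fq_ext m \<Longrightarrow> x \<in> W \<Longrightarrow> (\<lambda>v. c * x v) \<in> W"
    and trace: "\<And>c. c \<in> Fq_ext m \<Longrightarrow> (\<lambda>v. \<Sum>i<m. c ^ ((CARD('a) ^ r) ^ i) * g i v) \<in> W"
  shows "g 0 \<in> W"
proof -
  let ?Q = "CARD('a) ^ r"
  let ?L = "Fq_ext m :: 'a alg_closure set"
  obtain x where x: "\<And>j. 0 < j \<Longrightarrow> j < m \<Longrightarrow> x j \<in> ?L \<and> x j ^ (?Q ^ j) \<noteq> x j"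
    using frobenius_moves[where ?'a='a, OF m] by metis
  define h where "h J i = (\<Prod>j\<in>J. x j ^ (?Q ^ i) - x j ^ (?Q ^ j))" for J i
  have H: "\<forall>c\<in>?L. (\<lambda>v. \<Sum>i<m. c ^ (?Q ^ i) * h J i * g i v) \<in> W"
    if "finite J" "J \<subseteq> {1..<m}" for J
    using that
  proof (induction J)
    case empty
    show ?case using trace by (simp add: h_def)
  next
    case (insert j J)
    hence xj: "x j \<in> ?L" using x[of j] by simp
    show ?case
    proof
      fix c assume c: "c \<in> ?L"
      let ?d = "- (x j ^ (?Q ^ j))"
      let ?F = "\<lambda>c v. \<Sum>i<m. c ^ (?Q ^ i) * h J i * g i v"
      have "?d \<in> ?L"
        using Fq_ext_closed(2)[OF to_ac_in_Fq_ext[of 0] Fq_ext_closed(5)[OF xj xj]] by simp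
      hence "?F (c * x j) + (\<lambda>v. ?d * ?F c v) \<in> W"
        using insert.IH insert.prems c xj by (intro add scale) (auto intro: Fq_ext_closed)
      also have "?F (c * x j) + (\<lambda>v. ?d * ?F c v)
          = (\<lambda>v. \<Sum>i<m. c ^ (?Q ^ i) * h (insert j J) i * g i v)"
        using insert.hyps
        by (auto simp: h_def fun_eq_iff sum_distrib_left sum.distrib[symmetric] 
              power_mult_distrib algebra_simps intro!: sum.cong)
      finally show "(\<lambda>v. \<Sum>i<m. c ^ (?Q ^ i) * h (insert j J) i * g i v) \<in> W" .
    qed
  qed
  have h0: "h {1..<m} i = 0" if "i < m" "i \<noteq> 0" for i
    unfolding h_def by (rule prod_zero) (use that in auto)
  have "(\<lambda>v. \<Sum>i<m. 1 ^ (?Q ^ i) * h {1..<m} i * g i v) \<in> W"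
    using H[of "{1..<m}"] to_ac_in_Fq_ext[of 1 m] by (auto dest: bspec[of _ _ 1])
  also have "(\<lambda>v. \<Sum>i<m. 1 ^ (?Q ^ i) * h {1..<m} i * g i v) = (\<lambda>v. h {1..<m} 0 * g 0 v)"
  proof
    fix v
    have "(\<Sum>i<m. 1 ^ (?Q ^ i) * h {1..<m} i * g i v) = (\<Sum>i\<in>{0}. 1 ^ (?Q ^ i) * h {1..<m} i * g i v)"
      using m h0 by (intro sum.mono_neutral_right) auto
    thus "(\<Sum>i<m. 1 ^ (?Q ^ i) * h {1..<m} i * g i v) = h {1..<m} 0 * g 0 v" by simp
  qed
  finally have W0: "(\<lambda>v. h {1..<m} 0 * g 0 v) \<in> W" .
  have hL: "h {1..<m} 0 \<in> ?L"
  proof -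
    have "h J 0 \<in> ?L" if "finite J" "J \<subseteq> {1..<m}" for J
      using that
    proof (induction J)
      case empty
      show ?case using to_ac_in_Fq_ext[of 1 m] by (simp add: h_def)
    next
      case (insert j J)
      thus ?case using x[of j] by (simp add: h_def) (auto intro!: Fq_ext_closed)
    qed
    thus ?thesis by simp
  qed
  have hn0: "h {1..<m} 0 \<noteq> 0"
  proof
    assume "h {1..<m} 0 = 0"
    then obtain j where "j \<in> {1..<m}" "x j ^ (?Q ^ 0) - x j ^ (?Q ^ j) = 0"
      unfolding h_def by (subst (asm) prod_zero_iff) auto
    thus False using x[of j] by (metis atLeastLessThan_iff eq_iff_diff_eq_0 less_le_trans power_0 power_one_right zero_less_one)
  qed
  have "1 / h {1..<m} 0 \<in> ?L"
    using Fq_ext_closed(4)[OF to_ac_in_Fq_ext[of 1 m] hL] by simp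
  from scale[OF this W0] show ?thesis
    using hn0 by simp
qed

lemma span_coordinates:
  fixes b :: "nat \<Rightarrow> 'a::finite_field alg_closure" and N :: nat
  assumes w: "w = fq.dim (fq.span (b ` {..<N}))"
  obtains v c where "\<And>k. k < w \<Longrightarrow> v k \<in> b ` {..<N}"
    and "\<And>c. (\<Sum>k<w. to_ac (c k) * v k) = 0 \<Longrightarrow> \<forall>k<w. c k = 0"
    and "\<And>j. j < N \<Longrightarrow> b j = (\<Sum>k<w. to_ac (c j k) * v k)"
proof -
  obtain B where B: "B \<subseteq> b ` {..<N}" "fq.independent B" "b ` {..<N} \<subseteq> fq.span B"
      "card B = fq.dim (b ` {..<N})"
    by (rule fq.basis_exists)
  have fin: "finite B" using B(1) finite_surj by blast
  have cB: "card B = w" using B(4) by (simp add: w)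
  obtain v where v: "bij_betw v {..<w} B"
    using ex_bij_betw_nat_finite[OF fin] cB by (auto simp: atLeast0LessThan)
  have img: "v ` {..<w} = B" and inj: "inj_on v {..<w}"
    using v by (auto simp: bij_betw_def)
  have re: "(\<Sum>x\<in>B. fq_scale (g x) x) = (\<Sum>k<w. to_ac (g (v k)) * v k)" for g
    using sum.reindex_bij_betw[OF v, of "\<lambda>x. fq_scale (g x) x"] by (simp add: fq_scale_def)
  have "\<exists>g. b j = (\<Sum>k<w. to_ac (g k) * v k)" if "j < N" for j
  proof -
    have "b j \<in> fq.span B" using B(3) that by blast
    then obtain g where "b j = (\<Sum>x\<in>B. fq_scale (g x) x)"
      unfolding fq.span_finite[OF fin] by blast
    thus ?thesis using re by metis
  qed
  then obtain c where c: "\<And>j. j < N \<Longrightarrow> b j = (\<Sum>k<w. to_ac (c j k) * v k)" by metis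
  show thesis
  proof (rule that[OF _ _ c])
    show "v k \<in> b ` {..<N}" if "k < w" for k
      using that img B(1) by blast
    fix c assume 0: "(\<Sum>k<w. to_ac (c k) * v k) = 0"
    define g where "g x = c (the_inv_into {..<w} v x)" for x
    have g: "g (v k) = c k" if "k < w" for k
      using that inj by (simp add: g_def the_inv_into_f_f)
    have "(\<Sum>x\<in>B. fq_scale (g x) x) = 0"
      unfolding re using 0 g by simp
    hence "g x = 0" if "x \<in> B" for x
      using fq.independentD[OF B(2) fin subset_refl] that by blast
    thus "\<forall>k<w. c k = 0" using g img by force
  qed
qed

section \<open>The Drinfeld module as operators on the algebraic closure\<close>

lemma twisted_eval_eq:
  assumes "Polynomial.degree f \<le> N"
  shows "twisted_eval (f :: 'a::finite_field alg_closure poly) v = (\<Sum>i\<le>N. poly.coeff f i * v ^ (CARD('a) ^ i))"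
  unfolding twisted_eval_def
  by (rule sum.mono_neutral_left) (use assms in \<open>auto simp: coeff_eq_0 not_le\<close>)

lemma twisted_eval_0 [simp]: "twisted_eval 0 v = 0"
  by (simp add: twisted_eval_def)

lemma twisted_eval_add: "twisted_eval (f + g) v = twisted_eval f v + twisted_eval g v"
proof -
  let ?N = "max (Polynomial.degree f) (Polynomial.degree g)"
  have "Polynomial.degree (f + g) \<le> ?N" by (rule degree_add_le_max)
  thus ?thesis
    by (simp add: twisted_eval_eq[of _ ?N] distrib_right sum.distrib)
qed

lemma twisted_eval_sum: "twisted_eval (\<Sum>i\<in>A. g i) v = (\<Sum>i\<in>A. twisted_eval (g i) v)"
  by (induction A rule: infinite_finite_induct) (simp_all add: twisted_eval_add)

lemma twisted_eval_smult: "twisted_eval (Polynomial.smult c f) v = c * twisted_eval f v"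
  by (simp add: twisted_eval_eq[of _ "Polynomial.degree f"] degree_smult_le sum_distrib_left mult.assoc)

lemma twisted_eval_monom:
  "twisted_eval (Polynomial.monom c k) v = c * (v :: 'a::finite_field alg_closure) ^ (CARD('a) ^ k)"
proof -
  have "twisted_eval (Polynomial.monom c k) v
      = (\<Sum>i\<le>k. poly.coeff (Polynomial.monom c k) i * v ^ (CARD('a) ^ i))"
    by (rule twisted_eval_eq) (rule degree_monom_le)
  also have "\<dots> = (\<Sum>i\<le>k. if k = i then c * v ^ (CARD('a) ^ i) else 0)"
    by (intro sum.cong) auto
  finally show ?thesis by simp
qed

lemma twisted_eval_mult:
  "twisted_eval (twisted_mult f g) v = twisted_eval f (twisted_eval g v)"
  unfolding twisted_mult_def twisted_eval_sum twisted_eval_monom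
  unfolding twisted_eval_def frobenius_sum sum_distrib_left
  by (simp add: power_mult_distrib power_add power_mult[symmetric] mult_ac)

definition phi_T where
  "phi_T t n v = t * v + (v :: 'a::finite_field alg_closure) ^ (CARD('a) ^ n)"

lemma twisted_eval_drinfeld_T: "twisted_eval (drinfeld_T t n) v = phi_T t n v"
  by (simp add: drinfeld_T_def twisted_eval_add twisted_eval_monom phi_T_def)
     (simp add: twisted_eval_def)

lemma twisted_eval_drinfeld_T_power:
  "twisted_eval (drinfeld_T t n [^]\<^bsub>twisted_poly_ring r\<^esub> i) v = (phi_T t n ^^ i) v"
proof (induction i arbitrary: v)
  case 0
  show ?case by (simp add: nat_pow_def twisted_poly_ring_def twisted_eval_def)
next
  case (Suc i)
  have "drinfeld_T t n [^]\<^bsub>twisted_poly_ring r\<^esub> Suc i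
      = twisted_mult (drinfeld_T t n [^]\<^bsub>twisted_poly_ring r\<^esub> i) (drinfeld_T t n)"
    by (simp add: nat_pow_def twisted_poly_ring_def)
  thus ?case
    by (simp add: twisted_eval_mult Suc twisted_eval_drinfeld_T funpow_swap1)
qed

abbreviation phi where "phi r t n a \<equiv> twisted_eval (drinfeld r t n a)"

lemma phi_eq:
  "phi r t n a v = (\<Sum>i\<le>Polynomial.degree a. to_ac (poly.coeff a i) * (phi_T t n ^^ i) v)"
  by (simp add: drinfeld_def twisted_eval_sum twisted_eval_smult twisted_eval_drinfeld_T_power)

text \<open>
  The operator \<open>\<phi>\<^sub>a\<close> is a polynomial in \<open>\<phi>\<^sub>T\<close> with coefficients in \<open>\<bbbF>\<^sub>q\<close>. The commutation rules with
  Frobenius, with scalars and with another \<open>\<phi>\<^sub>b\<close> are all instances of this one.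
\<close>
lemma phi_commutes:
  fixes g :: "'a::finite_field alg_closure \<Rightarrow> 'a alg_closure"
  assumes add: "\<And>u v. g (u + v) = g u + g v"
    and scale: "\<And>c v. g (to_ac c * v) = to_ac c * g v"
    and T: "\<And>v. g (phi_T t n v) = phi_T t n (g v)"
  shows "g (phi r t n a v) = phi r t n a (g v)"
proof -
  have g0: "g 0 = 0" using add[of 0 0] by (simp only: add_0_right add_cancel_right_right)
  have gsum: "g (\<Sum>i\<in>A. h i) = (\<Sum>i\<in>A. g (h i))" for A :: "nat set" and h
    by (induction A rule: infinite_finite_induct) (simp_all add: g0 add)
  have "g ((phi_T t n ^^ i) v) = (phi_T t n ^^ i) (g v)" for i
    by (induction i) (simp_all add: T)
  thus ?thesis by (simp add: phi_eq gsum scale)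
qed

lemma phi_T_add: "phi_T t n (u + v) = phi_T t n u + phi_T t n v"
  by (simp add: phi_T_def frobenius_add algebra_simps)

lemma phi_T_scale: "c \<in> Fq_ext n \<Longrightarrow> phi_T t n (c * v) = c * phi_T t n v"
  by (simp add: phi_T_def Fq_ext_def power_mult_distrib algebra_simps)

lemma phi_add: "phi r t n a (u + v) = phi r t n a u + phi r t n a v"
proof -
  have "(phi_T t n ^^ i) (u + v) = (phi_T t n ^^ i) u + (phi_T t n ^^ i) v" for i
    by (induction i) (simp_all add: phi_T_add)
  thus ?thesis by (simp add: phi_eq distrib_left sum.distrib)
qed

lemma phi_0 [simp]: "phi r t n a 0 = 0"
  using phi_add[of r t n a 0 0] by (simp only: add_0_right add_cancel_right_right)

lemma phi_minus: "phi r t n a (- v) = - phi r t n a v"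
  using phi_add[of r t n a v "- v"] by (simp add: eq_neg_iff_add_eq_0 add.commute)

lemma phi_scale: "c \<in> Fq_ext n \<Longrightarrow> phi r t n a (c * v) = c * phi r t n a v"
  by (rule phi_commutes[symmetric]) (rule distrib_left mult.left_commute phi_T_scale[symmetric] | assumption)+

lemma phi_phi: "phi r t n a (phi r t n b v) = phi r t n b (phi r t n a v)"
  by (rule phi_commutes)
    (simp_all add: phi_add phi_scale phi_commutes[symmetric] phi_T_add phi_T_scale)

lemma phi_frobenius:
  fixes v :: "'a::finite_field alg_closure"
  assumes "t \<in> Fq_ext r"
  shows "phi r t n a (v ^ (CARD('a) ^ r)) = phi r t n a v ^ (CARD('a) ^ r)"
proof (rule phi_commutes[symmetric])
  show "phi_T t n v ^ (CARD('a) ^ r) = phi_T t n (v ^ (CARD('a) ^ r))" for v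
    using assms by (simp add: phi_T_def frobenius_add power_mult_distrib Fq_ext_def)
      (simp add: power_mult[symmetric] mult.commute)
qed (simp_all add: frobenius_add power_mult_distrib)

section \<open>The endomorphism ring of the torsion module\<close>

lemma torsion_closed:
  assumes "u \<in> torsion r t n p" "v \<in> torsion r t n p"
  shows "0 \<in> torsion r t n p" "u + v \<in> torsion r t n p" "- v \<in> torsion r t n p"
    "phi r t n a v \<in> torsion r t n p" "c \<in> Fq_ext n \<Longrightarrow> c * v \<in> torsion r t n p"
  using assms by (simp_all add: torsion_def phi_add phi_minus phi_scale phi_phi[of r t n p])

lemma torsion_0 [simp]: "0 \<in> torsion r t n p"
  by (simp add: torsion_def)

lemma torsion_frobenius_iff:
  fixes v :: "'a::finite_field alg_closure"
  assumes "t \<in> Fq_ext r"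
  shows "v ^ (CARD('a) ^ r) \<in> torsion r t n p \<longleftrightarrow> v \<in> torsion r t n p"
  by (simp add: torsion_def phi_frobenius[OF assms])

lemma mem_End:
  "g \<in> carrier (End_kappa r t n p) \<longleftrightarrow>
     (\<forall>v\<in>torsion r t n p. g v \<in> torsion r t n p) \<and> (\<forall>v. v \<notin> torsion r t n p \<longrightarrow> g v = 0) \<and>
     (\<forall>u\<in>torsion r t n p. \<forall>v\<in>torsion r t n p. g (u + v) = g u + g v) \<and>
     (\<forall>a. \<forall>v\<in>torsion r t n p. g (phi r t n a v) = phi r t n a (g v))"
  by (auto simp: End_kappa_def Let_def)

lemma End_at_0: "g \<in> carrier (End_kappa r t n p) \<Longrightarrow> g 0 = 0"
proof -
  assume "g \<in> carrier (End_kappa r t n p)"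
  hence "g (0 + 0) = g 0 + g 0"
    unfolding mem_End using torsion_0 by blast
  thus "g 0 = 0" by (simp only: add_0_right add_cancel_right_right)
qed

lemma End_ops [simp]:
  "x \<oplus>\<^bsub>End_kappa r t n p\<^esub> y = x + y" "x \<otimes>\<^bsub>End_kappa r t n p\<^esub> y = x \<circ> y"
  "\<zero>\<^bsub>End_kappa r t n p\<^esub> = 0" "\<one>\<^bsub>End_kappa r t n p\<^esub> = on_set (torsion r t n p) (\<lambda>v. v)"
  by (simp_all add: End_kappa_def Let_def zero_fun_def)

lemma End_closed:
  assumes "x \<in> carrier (End_kappa r t n p)" "y \<in> carrier (End_kappa r t n p)"
  shows "x + y \<in> carrier (End_kappa r t n p)" "- x \<in> carrier (End_kappa r t n p)"
    "x \<circ> y \<in> carrier (End_kappa r t n p)"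
    "c \<in> Fq_ext n \<Longrightarrow> (\<lambda>v. c * x v) \<in> carrier (End_kappa r t n p)"
  using assms End_at_0[OF assms(1)]
  by (auto simp: mem_End torsion_closed phi_add phi_minus phi_scale algebra_simps)

lemma End_zero_one:
  "0 \<in> carrier (End_kappa r t n p)"
  "on_set (torsion r t n p) (\<lambda>v. v) \<in> carrier (End_kappa r t n p)"
  by (auto simp: mem_End torsion_closed on_set_def)

lemma ring_End_kappa: "ring (End_kappa r t n p)"
proof (rule ringI)
  show "abelian_group (End_kappa r t n p)"
  proof (rule abelian_groupI)
    fix x assume "x \<in> carrier (End_kappa r t n p)"
    thus "\<exists>y\<in>carrier (End_kappa r t n p). y \<oplus>\<^bsub>End_kappa r t n p\<^esub> x = \<zero>\<^bsub>End_kappa r t n p\<^esub>"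
      by (intro bexI[of _ "- x"]) (auto simp: End_closed)
  qed (simp_all add: End_closed End_zero_one add_ac)
  show "Group.monoid (End_kappa r t n p)"
  proof (rule monoidI)
    fix x assume "x \<in> carrier (End_kappa r t n p)"
    thus "\<one>\<^bsub>End_kappa r t n p\<^esub> \<otimes>\<^bsub>End_kappa r t n p\<^esub> x = x"
      "x \<otimes>\<^bsub>End_kappa r t n p\<^esub> \<one>\<^bsub>End_kappa r t n p\<^esub> = x"
      using End_at_0[of x r t n p] by (auto simp: on_set_def fun_eq_iff mem_End)
  qed (simp_all add: End_closed End_zero_one comp_assoc)
next
  fix x y z
  assume xyz: "x \<in> carrier (End_kappa r t n p)" "y \<in> carrier (End_kappa r t n p)"
    "z \<in> carrier (End_kappa r t n p)"
  show "z \<otimes>\<^bsub>End_kappa r t n p\<^esub> (x \<oplus>\<^bsub>End_kappa r t n p\<^esub> y)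
      = z \<otimes>\<^bsub>End_kappa r t n p\<^esub> x \<oplus>\<^bsub>End_kappa r t n p\<^esub> z \<otimes>\<^bsub>End_kappa r t n p\<^esub> y"
  proof (simp, rule ext)
    fix v
    show "(z \<circ> (x + y)) v = ((z \<circ> x) + (z \<circ> y)) v"
      using xyz End_at_0[OF xyz(3)] by (cases "v \<in> torsion r t n p") (auto simp: mem_End)
  qed
qed (auto simp: fun_eq_iff)

lemma End_minus:
  assumes "x \<in> carrier (End_kappa r t n p)"
  shows "\<ominus>\<^bsub>End_kappa r t n p\<^esub> x = - x"
proof (rule abelian_group.minus_equality[OF ring.is_abelian_group[OF ring_End_kappa]])
  show "- x \<in> carrier (End_kappa r t n p)" by (rule End_closed(2)[OF assms assms])
qed (use assms in simp_all)

section \<open>Normal elements and the commutant of Frobenius\<close>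

text \<open>
  The commutant of \<open>\<pi>\<close> in \<open>End\<^sub>\<kappa>(M)\<close>, which equals \<open>S\<close> as soon as \<open>M\<close> has a normal element. Asking
  for the equation on the whole algebraic closure avoids a case distinction: for \<open>t \<in> \<bbbF>\<^bsub>q^r\<^esub>\<close>, Frobenius
  maps the complement of \<open>M\<close> to itself, and there both sides vanish.
\<close>
definition frob_commutant ::
    "nat \<Rightarrow> 'a::finite_field alg_closure \<Rightarrow> nat \<Rightarrow> 'a poly \<Rightarrow> ('a alg_closure \<Rightarrow> 'a alg_closure) set" where
  "frob_commutant r t n p =
     {g \<in> carrier (End_kappa r t n p). \<forall>v. g (v ^ (CARD('a) ^ r)) = g v ^ (CARD('a) ^ r)}"

locale normal_torsion =
  fixes p :: "'a::finite_field poly" and t \<alpha> :: "'a alg_closure" and n r m :: nat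
  assumes n_pos: "n \<ge> 1"
    and coprime_nr: "coprime n r"
    and t_in: "t \<in> Fq_ext r"
    and m_dvd: "m dvd n"
    and normal: "S_normal r t n p \<alpha>"
begin

abbreviation "M \<equiv> torsion r t n p"
abbreviation "E \<equiv> End_kappa r t n p"
abbreviation "\<Phi> \<equiv> phi r t n"
abbreviation "L \<equiv> (Fq_ext m :: 'a alg_closure set)"
abbreviation "S \<equiv> S_ring r t n p"
abbreviation "C \<equiv> frob_commutant r t n p"

sublocale E: ring E by (rule ring_End_kappa)

lemma m_pos: "m > 0" using n_pos m_dvd by (auto intro: Nat.gr0I)

lemma coprime_mr: "coprime m r"
  using coprime_nr m_dvd by (rule coprime_divisors[OF _ dvd_refl, rotated])

lemma L_subset: "c \<in> L \<Longrightarrow> c \<in> Fq_ext n"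
  using m_dvd Fq_ext_frobenius_multiple[of c m] by (auto simp: Fq_ext_def elim!: dvdE)

lemma frobenius_exponent: "v ^ (CARD('a) ^ (r * i)) = v ^ ((CARD('a) ^ r) ^ i)"
  by (simp add: power_mult)

lemma M_frob_iff: "v ^ ((CARD('a) ^ r) ^ i) \<in> M \<longleftrightarrow> v \<in> M"
  by (induction i) (simp_all add: power_Suc2 power_mult torsion_frobenius_iff[OF t_in] del: power_Suc)

lemma phi_frobenius_power: "\<Phi> a (v ^ ((CARD('a) ^ r) ^ i)) = \<Phi> a v ^ ((CARD('a) ^ r) ^ i)"
  by (induction i) (simp_all add: power_Suc2 power_mult phi_frobenius[OF t_in] del: power_Suc)

lemma frob_add: "(u + v) ^ ((CARD('a) ^ r) ^ i) = u ^ ((CARD('a) ^ r) ^ i) + (v :: 'a alg_closure) ^ ((CARD('a) ^ r) ^ i)"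
  using frobenius_add[of u v "r * i"] by (simp add: power_mult)

lemma frob_sum: "(\<Sum>k\<in>A. g k :: 'a alg_closure) ^ ((CARD('a) ^ r) ^ i) = (\<Sum>k\<in>A. g k ^ ((CARD('a) ^ r) ^ i))"
  using frobenius_sum[of g A "r * i"] by (simp add: power_mult)

lemma frobenius_power_in_commutant: "on_set M (\<lambda>v. v ^ ((CARD('a) ^ r) ^ i)) \<in> C"
proof -
  have "(v ^ (CARD('a) ^ r)) ^ ((CARD('a) ^ r) ^ i) = (v ^ ((CARD('a) ^ r) ^ i)) ^ (CARD('a) ^ r)"
    for v :: "'a alg_closure"
    by (metis power_mult mult.commute)
  thus ?thesis
    by (auto simp: frob_commutant_def mem_End on_set_def M_frob_iff frob_add phi_frobenius_power torsion_closed
        torsion_frobenius_iff[OF t_in])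
qed

lemma phi_in_commutant: "on_set M (\<Phi> a) \<in> C"
  by (auto simp: frob_commutant_def mem_End on_set_def phi_add phi_phi torsion_closed
        torsion_frobenius_iff[OF t_in] phi_frobenius[OF t_in])

lemma commutant_in_End: "g \<in> C \<Longrightarrow> g \<in> carrier E"
  by (simp add: frob_commutant_def)

lemma commutant_frobenius: "g \<in> C \<Longrightarrow> g (v ^ ((CARD('a) ^ r) ^ i)) = g v ^ ((CARD('a) ^ r) ^ i)"
  by (induction i) (simp_all add: power_Suc2 power_mult frob_commutant_def del: power_Suc)

lemma subring_commutant: "subring C E"
proof (rule E.subringI)
  show "C \<subseteq> carrier E" using commutant_in_End by blast
  show "\<one>\<^bsub>E\<^esub> \<in> C" using frobenius_power_in_commutant[of 0] by simp
next
  fix g assume g: "g \<in> C"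
  hence "\<ominus>\<^bsub>E\<^esub> g = - g" by (intro End_minus commutant_in_End)
  thus "\<ominus>\<^bsub>E\<^esub> g \<in> C"
    using g End_closed[OF commutant_in_End[OF g] commutant_in_End[OF g]] by (simp add: frob_commutant_def frobenius_minus)
next
  fix g h assume "g \<in> C" "h \<in> C"
  thus "g \<otimes>\<^bsub>E\<^esub> h \<in> C" "g \<oplus>\<^bsub>E\<^esub> h \<in> C"
    by (auto simp: frob_commutant_def End_closed frobenius_add)
qed

lemma generators_in_commutant: "insert (frob r t n p) (kappa_maps r t n p) \<subseteq> C"
  using frobenius_power_in_commutant[of 1] phi_in_commutant by (auto simp: frob_def kappa_maps_def)

lemma S_subset_commutant: "S \<subseteq> C"
  unfolding S_ring_def
  by (rule E.generate_ring_min_subring1[OF _ subring_commutant generators_in_commutant])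
    (use generators_in_commutant commutant_in_End in blast)

lemma End_sum:
  assumes "g \<in> carrier E" "\<And>i. i \<in> A \<Longrightarrow> h i \<in> M"
  shows "g (\<Sum>i\<in>A. h i) = (\<Sum>i\<in>A. g (h i))" "(\<Sum>i\<in>A. h i) \<in> M"
  using assms(2)
proof (induction A rule: infinite_finite_induct)
  case (insert a A)
  { case 1 thus ?case using insert assms(1) by (simp add: mem_End) }
  { case 2 thus ?case using insert by (simp add: torsion_closed) }
qed (use End_at_0[OF assms(1)] in auto)

lemma M_generated:
  assumes "v \<in> M"
  obtains c where "v = (\<Sum>i<n. \<Phi> (c i) (\<alpha> ^ ((CARD('a) ^ r) ^ i)))"
proof -
  have "\<forall>v\<in>M. \<exists>c. v = (\<Sum>i<n. \<Phi> (c i) (\<alpha> ^ ((CARD('a) ^ r) ^ i)))"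
    using normal unfolding S_normal_def is_kappa_basis_def frobenius_exponent by (elim conjE)
  thus thesis using assms that by blast
qed

lemma \<alpha>_in: "\<alpha> \<in> M"
  using normal by (simp add: S_normal_def)

text \<open>
  Elements of the commutant are linear over \<open>\<kappa>[\<pi>]\<close>, and \<open>\<alpha>\<close> generates \<open>M\<close> over \<open>\<kappa>[\<pi>]\<close>.
\<close>
lemma commutant_eqI:
  assumes "g \<in> C" "h \<in> C" "g \<alpha> = h \<alpha>"
  shows "g = h"
proof
  fix v
  show "g v = h v"
  proof (cases "v \<in> M")
    case True
    then obtain c where c: "v = (\<Sum>i<n. \<Phi> (c i) (\<alpha> ^ ((CARD('a) ^ r) ^ i)))" by (rule M_generated)
    have "f v = (\<Sum>i<n. \<Phi> (c i) (f \<alpha> ^ ((CARD('a) ^ r) ^ i)))" if f: "f \<in> C" for f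
    proof -
      have "f v = (\<Sum>i<n. f (\<Phi> (c i) (\<alpha> ^ ((CARD('a) ^ r) ^ i))))"
        unfolding c using f \<alpha>_in by (intro End_sum commutant_in_End) (auto simp: torsion_closed M_frob_iff)
      also have "\<dots> = (\<Sum>i<n. \<Phi> (c i) (f (\<alpha> ^ ((CARD('a) ^ r) ^ i))))"
        using commutant_in_End[OF f] \<alpha>_in by (simp add: mem_End M_frob_iff)
      finally show ?thesis using commutant_frobenius[OF f] by simp
    qed
    thus ?thesis using assms by metis
  next
    case False
    thus ?thesis using assms(1,2)[THEN commutant_in_End] by (simp add: mem_End)
  qed
qed

lemma S_eval_surj:
  assumes "v \<in> M"
  obtains x where "x \<in> S" "x \<alpha> = v"
proof -
  obtain c where c: "v = (\<Sum>i<n. \<Phi> (c i) (\<alpha> ^ ((CARD('a) ^ r) ^ i)))" using M_generated assms by blast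
  let ?H = "insert (frob r t n p) (kappa_maps r t n p)"
  have fr: "on_set M (\<lambda>v. v ^ ((CARD('a) ^ r) ^ i)) \<in> S" for i
  proof (induction i)
    case 0
    show ?case using generate_ring.one[of E ?H] by (simp add: S_ring_def)
  next
    case (Suc i)
    have "on_set M (\<lambda>v. v ^ ((CARD('a) ^ r) ^ Suc i)) = frob r t n p \<otimes>\<^bsub>E\<^esub> on_set M (\<lambda>v. v ^ ((CARD('a) ^ r) ^ i))"
      using M_frob_iff by (auto simp: frob_def on_set_def fun_eq_iff power_mult[symmetric] mult.commute)
    thus ?case
      using Suc generate_ring.incl[of "frob r t n p" ?H E] unfolding S_ring_def
      by (metis generate_ring.eng_mult insertI1)
  qed
  have product: "on_set M (\<Phi> a) \<circ> on_set M (\<lambda>v. v ^ ((CARD('a) ^ r) ^ i)) \<in> S" for a i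
    using generate_ring.eng_mult[of "on_set M (\<Phi> a)" E ?H] fr[of i]
      generate_ring.incl[of "on_set M (\<Phi> a)" ?H E] unfolding S_ring_def
    by (auto simp: kappa_maps_def)
  define x where "x k = (\<lambda>v. \<Sum>i<k. (on_set M (\<Phi> (c i)) \<circ> on_set M (\<lambda>v. v ^ ((CARD('a) ^ r) ^ i))) v)" for k
  have "x k \<in> S" for k
  proof (induction k)
    case 0
    show ?case using E.zero_in_generate[of ?H] by (simp add: x_def S_ring_def zero_fun_def)
  next
    case (Suc k)
    have "x (Suc k) = x k \<oplus>\<^bsub>E\<^esub> (on_set M (\<Phi> (c k)) \<circ> on_set M (\<lambda>v. v ^ ((CARD('a) ^ r) ^ k)))"
      by (simp add: x_def fun_eq_iff)
    thus ?case
      using Suc product[of "c k" k] unfolding S_ring_def by (metis generate_ring.eng_add)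
  qed
  moreover have "x n \<alpha> = v"
    unfolding c x_def using \<alpha>_in by (simp add: on_set_def M_frob_iff)
  ultimately show thesis using that by blast
qed

text \<open>
  \<open>M\<close> is a cyclic \<open>S\<close>-module generated by \<open>\<alpha>\<close>. Hence a commuting \<open>g\<close> agrees at \<open>\<alpha>\<close> with some element
  of \<open>S\<close>, and then agrees with it everywhere.
\<close>
lemma S_eq_commutant: "S = C"
proof
  show "C \<subseteq> S"
  proof
    fix g assume g: "g \<in> C"
    hence "g \<alpha> \<in> M" using commutant_in_End \<alpha>_in by (auto simp: mem_End)
    then obtain x where "x \<in> S" "x \<alpha> = g \<alpha>" by (rule S_eval_surj)
    thus "g \<in> S" using commutant_eqI[of x g] S_subset_commutant g by blast
  qed
qed (rule S_subset_commutant)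

section \<open>Combinations that vanish on conjugates of a normal element\<close>

text \<open>
  Since \<open>x\<^sub>k\<close> commutes with \<open>\<pi>\<close>, the \<open>i\<close>-th hypothesis reads
  \<open>\<Sum> v\<^sub>k \<pi>\<^sup>i(x\<^sub>k \<alpha>) = 0\<close>. Applying \<open>\<pi>\<^bsup>w-1-i\<^esup>\<close> puts the same unknowns \<open>\<pi>\<^bsup>w-1\<^esup>(x\<^sub>k \<alpha>)\<close> into every
  equation and moves the Frobenius powers to the coefficients \<open>v\<^sub>k\<close>, which yields a Moore system.
\<close>
lemma combination_vanishing:
  assumes v: "\<And>k. k < w \<Longrightarrow> v k \<in> L"
    and indep: "\<And>c. (\<Sum>k<w. to_ac (c k) * v k) = 0 \<Longrightarrow> \<forall>k<w. c k = (0 :: 'a)"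
    and x: "\<And>k. k < w \<Longrightarrow> x k \<in> C"
    and zero: "\<And>i. i < w \<Longrightarrow> (\<Sum>k<w. v k * x k (\<alpha> ^ ((CARD('a) ^ r) ^ i))) = 0"
  shows "\<forall>k<w. x k = 0"
proof (intro allI impI)
  fix k assume k: "k < w"
  have "\<forall>k<w. x k \<alpha> ^ ((CARD('a) ^ r) ^ (w - 1)) = 0"
  proof (rule moore_kernel_trivial[OF m_pos coprime_mr v indep])
    fix j assume j: "j < w"
    define i where "i = w - 1 - j"
    have i: "i < w" "i + j = w - 1" using j by (auto simp: i_def)
    have "0 = (\<Sum>k<w. v k * x k (\<alpha> ^ ((CARD('a) ^ r) ^ i))) ^ ((CARD('a) ^ r) ^ j)"
      using zero[OF i(1)] by simp
    also have "\<dots> = (\<Sum>k<w. v k ^ ((CARD('a) ^ r) ^ j) * x k \<alpha> ^ ((CARD('a) ^ r) ^ (w - 1)))"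
      unfolding frob_sum i(2)[symmetric]
      by (intro sum.cong refl) (simp add: power_mult_distrib commutant_frobenius[OF x] power_add power_mult)
    finally show "(\<Sum>k<w. v k ^ ((CARD('a) ^ r) ^ j) * x k \<alpha> ^ ((CARD('a) ^ r) ^ (w - 1))) = 0" by simp
  qed auto
  hence "x k \<alpha> = 0" using k by simp
  moreover have "0 \<in> C" using subringE(2)[OF subring_commutant] by simp
  ultimately show "x k = 0" using x[OF k] by (intro commutant_eqI) auto
qed

text \<open>
  Rewriting \<open>\<Sum> b\<^sub>j s\<^sub>j\<close> in terms of a basis \<open>v\<^sub>1, \<dots>, v\<^sub>w\<close> of the span of the \<open>b\<^sub>j\<close> gives \<open>\<Sum> v\<^sub>k x\<^sub>k\<close> with
  only \<open>w\<close> summands and \<open>x\<^sub>k \<in> S\<close>, so \<open>w\<close> consecutive zeros are enough to conclude. The statement gives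
  the uniqueness of coordinates and the weight bound at once.
\<close>
lemma coordinates_vanish:
  assumes s: "is_fq_basis N s S"
    and b: "\<And>j. j < N \<Longrightarrow> b j \<in> L"
    and zero: "\<And>i. i < fq.dim (fq.span (b ` {..<N})) \<Longrightarrow> (\<Sum>j<N. b j * s j (\<alpha> ^ ((CARD('a) ^ r) ^ i))) = 0"
  shows "\<forall>j<N. b j = 0"
proof -
  define w where "w = fq.dim (fq.span (b ` {..<N}))"
  obtain v c where v: "\<And>k. k < w \<Longrightarrow> v k \<in> b ` {..<N}"
    and indep: "\<And>c. (\<Sum>k<w. to_ac (c k) * v k) = 0 \<Longrightarrow> \<forall>k<w. c k = 0"
    and bc: "\<And>j. j < N \<Longrightarrow> b j = (\<Sum>k<w. to_ac (c j k) * v k)"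
    by (rule span_coordinates[OF w_def]) blast
  define x where "x k = (\<Sum>j<N. fq_scale_fun (c j k) (s j))" for k
  have S: "S = fq_fun.span (s ` {..<N})" and inj: "inj_on s {..<N}"
    and ind: "fq_fun.independent (s ` {..<N})"
    using s by (auto simp: is_fq_basis_def)
  have x_app: "x k v = (\<Sum>j<N. to_ac (c j k) * s j v)" for k v
  proof -
    have "(\<Sum>j\<in>A. fq_scale_fun (c j k) (s j)) v = (\<Sum>j\<in>A. to_ac (c j k) * s j v)" for A
      by (induction A rule: infinite_finite_induct) (simp_all add: fq_scale_fun_def fq_scale_def)
    thus ?thesis by (simp add: x_def)
  qed
  have "\<forall>k<w. x k = 0"
  proof (rule combination_vanishing[where v = v and x = x and w = w])
    show "v k \<in> L" if "k < w" for k using v[OF that] b by auto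
    show "\<forall>k<w. c k = 0" if "(\<Sum>k<w. to_ac (c k) * v k) = 0" for c
      using that by (rule indep)
    show "x k \<in> C" for k
      unfolding S_eq_commutant[symmetric] S x_def
      by (intro fq_fun.span_sum fq_fun.span_scale fq_fun.span_base) auto
    fix i assume "i < w"
    have "(\<Sum>k<w. v k * x k u) = (\<Sum>j<N. b j * s j u)" for u
      unfolding x_app sum_distrib_left
      by (subst sum.swap) (simp add: bc sum_distrib_left sum_distrib_right mult_ac)
    thus "(\<Sum>k<w. v k * x k (\<alpha> ^ ((CARD('a) ^ r) ^ i))) = 0" using zero[of i] \<open>i < w\<close> by (simp add: w_def)
  qed
  hence "c j k = 0" if "k < w" "j < N" for j k
  proof -
    have "(\<Sum>y\<in>s ` {..<N}. fq_scale_fun (c (the_inv_into {..<N} s y) k) y) = x k"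
      unfolding x_def sum.reindex[OF inj] by (simp add: the_inv_into_f_f[OF inj])
    also have "\<dots> = 0" using \<open>\<forall>k<w. x k = 0\<close> that by simp
    finally have "c (the_inv_into {..<N} s (s j)) k = 0"
      using fq_fun.independentD[where u = "\<lambda>y. c (the_inv_into {..<N} s y) k", OF ind _ subset_refl] that
      by blast
    thus ?thesis using that by (simp add: the_inv_into_f_f[OF inj])
  qed
  thus ?thesis using bc by simp
qed

section \<open>Existence of coordinates by descent\<close>

text \<open>Conjugation by \<open>\<pi>\<close>, that is \<open>g \<mapsto> \<pi> g \<pi>\<inverse>\<close>; Frobenius is bijective on the algebraic closure.\<close>

definition frob_conj :: "('a alg_closure \<Rightarrow> 'a alg_closure) \<Rightarrow> 'a alg_closure \<Rightarrow> 'a alg_closure" where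
  "frob_conj g v = g (the_inv (\<lambda>u. u ^ (CARD('a) ^ r)) v) ^ (CARD('a) ^ r)"

lemma frob_conj_frob: "frob_conj g (v ^ (CARD('a) ^ r)) = g v ^ (CARD('a) ^ r)"
  using the_inv_f_f[OF bij_is_inj[OF frobenius_bij[where ?'a='a and k=r]]] by (simp add: frob_conj_def)

lemma frob_surj:
  obtains u :: "'a alg_closure" where "v = u ^ (CARD('a) ^ r)"
  using bij_is_surj[OF frobenius_bij[where ?'a='a and k=r]] by (rule surjE)

lemma frob_conj_End:
  assumes "g \<in> carrier E"
  shows "frob_conj g \<in> carrier E"
proof -
  have "frob_conj g v \<in> M" if "v \<in> M" for v
    using that assms by (cases v rule: frob_surj) 
      (auto simp: frob_conj_frob torsion_frobenius_iff[OF t_in] mem_End)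
  moreover have "frob_conj g v = 0" if "v \<notin> M" for v
    using that assms by (cases v rule: frob_surj) 
      (auto simp: frob_conj_frob torsion_frobenius_iff[OF t_in] mem_End)
  moreover have "frob_conj g (u + v) = frob_conj g u + frob_conj g v" if "u \<in> M" "v \<in> M" for u v
  proof -
    obtain u' v' where uv: "u = u' ^ (CARD('a) ^ r)" "v = v' ^ (CARD('a) ^ r)"
      using frob_surj by metis
    hence "u' \<in> M" "v' \<in> M" using that by (auto simp: torsion_frobenius_iff[OF t_in])
    hence "g (u' + v') = g u' + g v'" using assms by (simp add: mem_End)
    thus ?thesis
      unfolding uv frobenius_add[symmetric] frob_conj_frob by (simp add: frobenius_add)
  qed
  moreover have "frob_conj g (\<Phi> a v) = \<Phi> a (frob_conj g v)" if "v \<in> M" for a v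
    using that assms
    by (cases v rule: frob_surj)
      (auto simp: frob_conj_frob torsion_frobenius_iff[OF t_in] mem_End phi_frobenius[OF t_in])
  ultimately show ?thesis unfolding mem_End by blast
qed

lemma commutant_if_frob_conj_fixed:
  assumes "g \<in> carrier E" "frob_conj g = g"
  shows "g \<in> C"
  using assms frob_conj_frob[of g] by (simp add: frob_commutant_def)

lemma frob_conj_iter: "(frob_conj ^^ i) g (v ^ ((CARD('a) ^ r) ^ i)) = g v ^ ((CARD('a) ^ r) ^ i)"
proof (induction i arbitrary: v)
  case (Suc i)
  have "v ^ ((CARD('a) ^ r) ^ Suc i) = (v ^ ((CARD('a) ^ r) ^ i)) ^ (CARD('a) ^ r)" for v :: "'a alg_closure"
    by (simp add: power_mult[symmetric] mult.commute)
  thus ?case using Suc by (simp add: frob_conj_frob)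
qed simp

lemma frob_nat_pow: "frob r t n p [^]\<^bsub>E\<^esub> k = on_set M (\<lambda>v. v ^ ((CARD('a) ^ r) ^ k))" for k :: nat
proof (induction k)
  case (Suc k)
  have "frob r t n p [^]\<^bsub>E\<^esub> Suc k = on_set M (\<lambda>v. v ^ ((CARD('a) ^ r) ^ k)) \<circ> frob r t n p"
    using Suc by (simp add: E.nat_pow_Suc)
  thus ?case
    by (auto simp: frob_def on_set_def fun_eq_iff torsion_frobenius_iff[OF t_in] power_mult)
qed simp

text \<open>
  Elements of \<open>R\<close> commute with \<open>\<pi>\<^sup>m\<close>, so on \<open>R\<close> conjugation by \<open>\<pi>\<close> is an action of the cyclic group
  of order \<open>m\<close>, semilinear over \<open>L\<close>.
\<close>
lemma R_periodic:
  assumes "f \<in> R_ring r t n p m"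
  shows "f \<in> carrier E" "(frob_conj ^^ m) f = f"
proof -
  show fE: "f \<in> carrier E"
    using assms by (simp add: R_ring_def centralizer_def)
  have "frob r t n p [^]\<^bsub>E\<^esub> m \<in> R0_ring r t n p m"
    unfolding R0_ring_def by (rule generate_ring.incl) simp
  hence comm: "f \<circ> on_set M (\<lambda>v. v ^ ((CARD('a) ^ r) ^ m)) = on_set M (\<lambda>v. v ^ ((CARD('a) ^ r) ^ m)) \<circ> f"
    using assms unfolding frob_nat_pow by (simp add: R_ring_def centralizer_def)
  show "(frob_conj ^^ m) f = f"
  proof
    fix v :: "'a alg_closure"
    obtain u where u: "v = u ^ ((CARD('a) ^ r) ^ m)"
      using frobenius_bij[where ?'a='a and k="r * m"] by (metis bij_pointE power_mult)
    have "f (u ^ ((CARD('a) ^ r) ^ m)) = f u ^ ((CARD('a) ^ r) ^ m)"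
    proof (cases "u \<in> M")
      case True
      thus ?thesis using fun_cong[OF comm, of u] fE by (simp add: on_set_def mem_End)
    next
      case False
      thus ?thesis using fE by (simp add: mem_End M_frob_iff)
    qed
    thus "(frob_conj ^^ m) f v = f v" by (simp add: u frob_conj_iter)
  qed
qed

lemma frob_conj_sum: "frob_conj (\<lambda>v. \<Sum>i\<in>A. g i v) = (\<lambda>v. \<Sum>i\<in>A. frob_conj (g i) v)"
  by (simp add: fun_eq_iff frob_conj_def frobenius_sum)

lemma frob_conj_scale: "frob_conj (\<lambda>v. c * g v) = (\<lambda>v. c ^ (CARD('a) ^ r) * frob_conj g v)"
  by (simp add: fun_eq_iff frob_conj_def power_mult_distrib)

lemma trace_in_commutant:
  assumes f: "f \<in> R_ring r t n p m" and c: "c \<in> L"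
  shows "(\<lambda>v. \<Sum>i<m. c ^ ((CARD('a) ^ r) ^ i) * (frob_conj ^^ i) f v) \<in> C"
proof (rule commutant_if_frob_conj_fixed)
  define h where "h i = (\<lambda>v. c ^ ((CARD('a) ^ r) ^ i) * (frob_conj ^^ i) f v)" for i
  have hE: "h i \<in> carrier E" for i
  proof -
    have "(frob_conj ^^ i) f \<in> carrier E"
      by (induction i) (simp_all add: R_periodic(1)[OF f] frob_conj_End)
    moreover have "c ^ ((CARD('a) ^ r) ^ i) \<in> Fq_ext n" using Fq_ext_closed(5)[OF c c] by (rule L_subset)
    ultimately show ?thesis unfolding h_def by (intro End_closed)
  qed
  have "(\<lambda>v. \<Sum>i<k. h i v) \<in> carrier E" for k
  proof (induction k)
    case 0
    show ?case using End_zero_one(1)[of r t n p] by (simp add: zero_fun_def)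
  next
    case (Suc k)
    thus ?case using End_closed(1)[OF Suc hE[of k]] by (simp add: plus_fun_def)
  qed
  thus "(\<lambda>v. \<Sum>i<m. c ^ ((CARD('a) ^ r) ^ i) * (frob_conj ^^ i) f v) \<in> carrier E"
    by (simp add: h_def)
  have step: "frob_conj (h i) = h (Suc i)" for i
  proof -
    have "(c ^ ((CARD('a) ^ r) ^ i)) ^ (CARD('a) ^ r) = c ^ ((CARD('a) ^ r) ^ Suc i)"
      by (simp only: power_mult[symmetric] power_Suc mult.commute)
    thus ?thesis by (simp only: h_def frob_conj_scale funpow.simps comp_apply)
  qed
  have "c ^ ((CARD('a) ^ r) ^ m) = c"
    using Fq_ext_frobenius_multiple[OF c, of r] by (simp add: power_mult[symmetric] mult.commute)
  hence hm: "h m = h 0" by (simp add: h_def R_periodic(2)[OF f])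
  have shift: "(\<Sum>i<m. h (Suc i) v) = (\<Sum>i<m. h i v)" for v
    using sum.lessThan_Suc_shift[of "\<lambda>i. h i v" m] hm by simp
  have eq: "(\<lambda>v. \<Sum>i<m. c ^ ((CARD('a) ^ r) ^ i) * (frob_conj ^^ i) f v) = (\<lambda>v. \<Sum>i<m. h i v)"
    by (simp add: h_def)
  show "frob_conj (\<lambda>v. \<Sum>i<m. c ^ ((CARD('a) ^ r) ^ i) * (frob_conj ^^ i) f v)
      = (\<lambda>v. \<Sum>i<m. c ^ ((CARD('a) ^ r) ^ i) * (frob_conj ^^ i) f v)"
    unfolding eq frob_conj_sum step shift by (rule refl)
qed

text \<open>
  This is the surjectivity of \<open>L \<otimes> S \<rightarrow> R\<close>. The traces of the multiples \<open>c f\<close> under conjugation by \<open>\<pi>\<close>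
  commute with \<open>\<pi>\<close>, so they lie in \<open>S\<close>, and descent recovers \<open>f\<close> from them.
\<close>
lemma coordinates_exist:
  assumes s: "is_fq_basis N s S" and f: "f \<in> R_ring r t n p m"
  shows "\<exists>b. (\<forall>j<N. b j \<in> L) \<and> f = (\<lambda>v. \<Sum>j<N. b j * s j v)"
proof -
  define W where "W = {(\<lambda>v. \<Sum>j<N. b j * s j v) | b. \<forall>j<N. b j \<in> L}"
  have C_W: "g \<in> W" if "g \<in> C" for g
  proof -
    have inj: "inj_on s {..<N}" using s by (simp add: is_fq_basis_def)
    have "g \<in> fq_fun.span (s ` {..<N})"
      using s that S_eq_commutant by (simp add: is_fq_basis_def)
    then obtain d where "g = (\<Sum>y\<in>s ` {..<N}. fq_scale_fun (d y) y)"
      unfolding fq_fun.span_finite[OF finite_imageI[OF finite_lessThan]] by blast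
    hence g: "g = (\<Sum>j<N. fq_scale_fun (d (s j)) (s j))"
      by (simp add: sum.reindex[OF inj])
    have "(\<Sum>j\<in>A. fq_scale_fun (d (s j)) (s j)) v = (\<Sum>j\<in>A. to_ac (d (s j)) * s j v)" for A v
      by (induction A rule: infinite_finite_induct) (simp_all add: fq_scale_fun_def fq_scale_def)
    hence "g = (\<lambda>v. \<Sum>j<N. to_ac (d (s j)) * s j v)" unfolding g by auto
    thus ?thesis unfolding W_def by force
  qed
  have "(frob_conj ^^ 0) f \<in> W"
  proof (rule galois_descent[OF m_pos coprime_mr])
    fix x y assume "x \<in> W" "y \<in> W"
    then obtain b b' where "\<forall>j<N. b j \<in> L" "x = (\<lambda>v. \<Sum>j<N. b j * s j v)"
      "\<forall>j<N. b' j \<in> L" "y = (\<lambda>v. \<Sum>j<N. b' j * s j v)" unfolding W_def by blast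
    thus "x + y \<in> W" unfolding W_def
      by (intro CollectI exI[of _ "\<lambda>j. b j + b' j"])
        (auto simp: fun_eq_iff distrib_right sum.distrib intro: Fq_ext_closed)
  next
    fix c x assume "c \<in> L" "x \<in> W"
    then obtain b where "\<forall>j<N. b j \<in> L" "x = (\<lambda>v. \<Sum>j<N. b j * s j v)" unfolding W_def by blast
    with \<open>c \<in> L\<close> show "(\<lambda>v. c * x v) \<in> W" unfolding W_def
      by (intro CollectI exI[of _ "\<lambda>j. c * b j"])
        (auto simp: fun_eq_iff sum_distrib_left mult.assoc intro: Fq_ext_closed)
  next
    fix c assume "c \<in> L"
    thus "(\<lambda>v. \<Sum>i<m. c ^ ((CARD('a) ^ r) ^ i) * (frob_conj ^^ i) f v) \<in> W"
      by (intro C_W trace_in_commutant f)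
  qed
  thus ?thesis by (auto simp: W_def)
qed

text \<open>
  The coordinates are defined by definite description, so both existence and uniqueness have to
  be known before anything can be said about them.
\<close>
lemma L_coords_representation:
  assumes s: "is_fq_basis N s S" and f: "f \<in> R_ring r t n p m"
  shows "L_coords m N s f \<in> {..<N} \<rightarrow>\<^sub>E L \<and> f = (\<lambda>v. \<Sum>j<N. L_coords m N s f j * s j v)"
  unfolding L_coords_def
proof (rule theI'[where P = "\<lambda>b. b \<in> {..<N} \<rightarrow>\<^sub>E L \<and> f = (\<lambda>v. \<Sum>j<N. b j * s j v)"])
  obtain b where b: "\<forall>j<N. b j \<in> L" "f = (\<lambda>v. \<Sum>j<N. b j * s j v)"
    using coordinates_exist[OF s f] by blast
  show "\<exists>!b. b \<in> {..<N} \<rightarrow>\<^sub>E L \<and> f = (\<lambda>v. \<Sum>j<N. b j * s j v)"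
  proof (rule ex1I[of _ "restrict b {..<N}"])
    show "restrict b {..<N} \<in> {..<N} \<rightarrow>\<^sub>E L \<and> f = (\<lambda>v. \<Sum>j<N. restrict b {..<N} j * s j v)"
      using b by auto
    fix b' assume b': "b' \<in> {..<N} \<rightarrow>\<^sub>E L \<and> f = (\<lambda>v. \<Sum>j<N. b' j * s j v)"
    have "\<forall>j<N. b' j - b j = 0"
    proof (rule coordinates_vanish[OF s])
      show "b' j - b j \<in> L" if "j < N" for j
        using b b' that by (intro Fq_ext_closed) (auto simp: PiE_iff)
      have "(\<Sum>j<N. b' j * s j v) = (\<Sum>j<N. b j * s j v)" for v
        using b b' by metis
      thus "(\<Sum>j<N. (b' j - b j) * s j (\<alpha> ^ ((CARD('a) ^ r) ^ i))) = 0" for i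
        by (simp add: left_diff_distrib sum_subtractf)
    qed
    thus "b' = restrict b {..<N}"
      using b' by (intro PiE_ext[of _ "{..<N}" "\<lambda>_. L"]) (use b in auto)
  qed
qed

section \<open>The bound for the rank weight\<close>

lemma nonzero_at_conjugate_below_rank_wt:
  assumes s: "is_fq_basis N s S" and f: "f \<in> R_ring r t n p m" "f \<noteq> (\<lambda>_. 0)"
  shows "\<exists>i < rank_wt m N s f. f (\<alpha> ^ ((CARD('a) ^ r) ^ i)) \<noteq> 0"
proof (rule ccontr)
  define b where "b = L_coords m N s f"
  have bf: "b \<in> {..<N} \<rightarrow>\<^sub>E L \<and> f = (\<lambda>v. \<Sum>j<N. b j * s j v)"
    unfolding b_def by (rule L_coords_representation[OF s f(1)])
  hence b: "b j \<in> L" if "j < N" for j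
    using that by (auto simp: PiE_iff)
  have fb: "f = (\<lambda>v. \<Sum>j<N. b j * s j v)"
    using bf by blast
  assume "\<not> ?thesis"
  hence zero: "f (\<alpha> ^ ((CARD('a) ^ r) ^ i)) = 0" if "i < fq.dim (fq.span (b ` {..<N}))" for i
    using that by (auto simp: rank_wt_def b_def)
  have "\<forall>j<N. b j = 0"
  proof (rule coordinates_vanish[OF s b])
    fix i assume "i < fq.dim (fq.span (b ` {..<N}))"
    from zero[OF this] show "(\<Sum>j<N. b j * s j (\<alpha> ^ ((CARD('a) ^ r) ^ i))) = 0"
      by (simp only: fb)
  qed
  hence "f = (\<lambda>_. 0)" by (simp add: fb)
  thus False using f(2) by contradiction
qed

end

theorem theorem5p6:
  fixes p0 p :: "'a::finite_field poly"
    and t \<alpha> :: "'a alg_closure"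
    and n r m d :: nat
    and s :: "nat \<Rightarrow> 'a alg_closure \<Rightarrow> 'a alg_closure"
    and f :: "'a alg_closure \<Rightarrow> 'a alg_closure"
    and \<delta> :: int
  assumes "n \<ge> 1"
    and "irreducible p0" and "lead_coeff p0 = 1" and "Polynomial.degree p0 = r"
    and "coprime n r"
    and "t \<in> Fq_ext r" and "poly (map_poly to_ac p0) t = 0"
    and "irreducible p" and "lead_coeff p = 1" and "Polynomial.degree p = d"
    and "p \<noteq> p0"
    and "m dvd n"
    and "is_fq_basis (n * d) s (S_ring r t n p)"
    and "S_normal r t n p \<alpha>"
    and "f \<in> R_ring r t n p m" and "f \<noteq> (\<lambda>_. 0)"
    and "{v \<in> torsion r t n p. f v = 0} \<supseteq> {\<alpha> ^ (CARD('a) ^ (r * i)) | i. int i \<le> \<delta> - 2}"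
  shows "int (rank_wt m (n * d) s f) \<ge> \<delta>"
proof -
  interpret normal_torsion p t \<alpha> n r m
    by (rule normal_torsion.intro) (fact assms)+
  obtain i where i: "i < rank_wt m (n * d) s f" "f (\<alpha> ^ ((CARD('a) ^ r) ^ i)) \<noteq> 0"
    using nonzero_at_conjugate_below_rank_wt[OF assms(13,15,16)] by blast
  have "\<not> int i \<le> \<delta> - 2"
  proof
    assume "int i \<le> \<delta> - 2"
    hence "\<alpha> ^ (CARD('a) ^ (r * i)) \<in> {v \<in> torsion r t n p. f v = 0}"
      using assms(17) by blast
    thus False using i(2) by (simp add: frobenius_exponent)
  qed
  thus ?thesis using i(1) by linarith
qed

end
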